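(* There is a large enough absolute constant $c>0$ such that the following holds. Let $p$ be a prime, let $n,t,e\in\mathbb{N}^+$ and $d,\epsilon'>0$ with $n\geq c$ and $t\log p\leq c^{-1}n\log p-2\log(de/\epsilon')$, and let $\epsilon=dp^{-n/2}$. Then there exists an explicit deterministic $\epsilon'$-extractor $f:\mathbb{F}_p^n\to\mathbb{F}_p^t$ for $(\epsilon,e)$-biased sources distributed over $\mathbb{F}_p^n$.
   Context: Logarithms are base 2. A distribution $D$ over a finite abelian group $A$ is $(\epsilon,e)$-biased if $|\mathbb{E}[\chi(D)]|\leq\epsilon$ for all but at most $e$ characters $\chi$ of $A$ (here $A=(\mathbb{F}_p^n,+)$). A function is an $\epsilon'$-extractor for a class of distributions if its output on every distribution of the class is $\epsilon'$-close in statistical distance to uniform on its codomain. Explicit means polynomial-time computable.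
   Formalization: The formal theorem assumes d ≥ 1 instead of d > 0; for arbitrary d > 0 the claim fails (p = 2, e = 1, ε' = 1/4, d = 2^(-n-10), t = n+1 with the uniform source). *)

theory Defs
  imports
    "HOL-Probability.Probability"
    "HOL-Algebra.Product_Groups"
    "HOL-Number_Theory.Residues"
    "HOL-Computational_Algebra.Polynomial"
    "HOL-Library.Log_Nat"
begin

section \<open>Biased distributions and extractors\<close>

definition complex_units :: "complex monoid" where
  "complex_units = \<lparr>carrier = UNIV - {0}, mult = (*), one = 1\<rparr>"

text \<open>Characters are made extensional so that distinct members of the set are distinct
  functions on the group and may be counted.\<close>

definition characters :: "('a, 'b) monoid_scheme \<Rightarrow> ('a \<Rightarrow> complex) set" where
  "characters G = hom G complex_units \<inter> extensional (carrier G)"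

definition biased :: "('a, 'b) monoid_scheme \<Rightarrow> real \<Rightarrow> nat \<Rightarrow> 'a pmf \<Rightarrow> bool" where
  "biased G \<epsilon> e D \<longleftrightarrow>
     (\<exists>S \<subseteq> characters G. finite S \<and> card S \<le> e \<and>
        (\<forall>\<psi> \<in> characters G - S. cmod (measure_pmf.expectation D \<psi>) \<le> \<epsilon>))"

definition biased_sources :: "('a, 'b) monoid_scheme \<Rightarrow> real \<Rightarrow> nat \<Rightarrow> 'a pmf set" where
  "biased_sources G \<epsilon> e = {D. set_pmf D \<subseteq> carrier G \<and> biased G \<epsilon> e D}"

definition stat_dist :: "'a pmf \<Rightarrow> 'a pmf \<Rightarrow> real" where
  "stat_dist P Q = (SUP S. \<bar>measure_pmf.prob P S - measure_pmf.prob Q S\<bar>)"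

definition extractor ::
  "real \<Rightarrow> 'a set \<Rightarrow> 'b set \<Rightarrow> 'a pmf set \<Rightarrow> ('a \<Rightarrow> 'b) \<Rightarrow> bool" where
  "extractor \<epsilon> A B \<D> f \<longleftrightarrow>
     f \<in> A \<rightarrow> B \<and> (\<forall>D \<in> \<D>. stat_dist (map_pmf f D) (pmf_of_set B) \<le> \<epsilon>)"

definition Fp_vec :: "nat \<Rightarrow> nat \<Rightarrow> (nat \<Rightarrow> int) monoid" where
  "Fp_vec p n = product_group {..<n} (\<lambda>_. add_monoid (residue_ring (int p)))"


section \<open>Polynomial time\<close>

text \<open>The model of computation is the random access machine of Aho, Hopcroft and Ullman (The
  Design and Analysis of Computer Algorithms, Section 1.2): integer registers with register 0 as
  accumulator, a read-only input tape and a write-only output tape holding integers, and the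
  logarithmic cost criterion. It is polynomially equivalent to Turing machines.

  The operands \<open>Imm i\<close>, \<open>Reg i\<close>, \<open>Ind i\<close> are the book's \<open>=i\<close>, \<open>i\<close>, \<open>*i\<close>. An illegal access (negative
  indirect address, immediate target, read past the end of the input) blocks the machine, and a
  blocked run does not count as halting.\<close>

datatype operand = Imm int | Reg nat | Ind nat

datatype instr =
    LOAD operand | STORE operand
  | ADD operand | SUB operand | MULT operand | DIV operand
  | READ operand | WRITE operand
  | JUMP nat | JGTZ nat | JZERO nat | HALT

type_synonym regs = "nat \<Rightarrow> int"

text \<open>Program counter, registers, unread input, output written so far.\<close>

type_synonym ram_state = "nat \<times> regs \<times> int list \<times> int list"

text \<open>Length of the binary representation, with length 1 for the number 0.\<close>

definition len :: "int \<Rightarrow> nat" where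
  "len i = max 1 (floorlog 2 (nat \<bar>i\<bar>))"

fun op_val :: "regs \<Rightarrow> operand \<Rightarrow> int option" where
  "op_val r (Imm i) = Some i"
| "op_val r (Reg i) = Some (r i)"
| "op_val r (Ind i) = (if r i < 0 then None else Some (r (nat (r i))))"

fun op_cost :: "regs \<Rightarrow> operand \<Rightarrow> nat" where
  "op_cost r (Imm i) = len i"
| "op_cost r (Reg i) = len (int i) + len (r i)"
| "op_cost r (Ind i) = len (int i) + len (r i) + len (r (nat (r i)))"

fun target :: "regs \<Rightarrow> operand \<Rightarrow> nat option" where
  "target r (Imm i) = None"
| "target r (Reg i) = Some i"
| "target r (Ind i) = (if r i < 0 then None else Some (nat (r i)))"

fun target_cost :: "regs \<Rightarrow> operand \<Rightarrow> nat" where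
  "target_cost r (Imm i) = len i"
| "target_cost r (Reg i) = len (int i)"
| "target_cost r (Ind i) = len (int i) + len (r i)"

fun ram_step :: "instr \<Rightarrow> ram_state \<Rightarrow> ram_state option" where
  "ram_step (LOAD a) (pc, r, xs, ys) = map_option (\<lambda>v. (pc + 1, r(0 := v), xs, ys)) (op_val r a)"
| "ram_step (STORE a) (pc, r, xs, ys) = map_option (\<lambda>i. (pc + 1, r(i := r 0), xs, ys)) (target r a)"
| "ram_step (ADD a) (pc, r, xs, ys) = map_option (\<lambda>v. (pc + 1, r(0 := r 0 + v), xs, ys)) (op_val r a)"
| "ram_step (SUB a) (pc, r, xs, ys) = map_option (\<lambda>v. (pc + 1, r(0 := r 0 - v), xs, ys)) (op_val r a)"
| "ram_step (MULT a) (pc, r, xs, ys) = map_option (\<lambda>v. (pc + 1, r(0 := r 0 * v), xs, ys)) (op_val r a)"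
| "ram_step (DIV a) (pc, r, xs, ys) = map_option (\<lambda>v. (pc + 1, r(0 := r 0 div v), xs, ys)) (op_val r a)"
| "ram_step (READ a) (pc, r, xs, ys) =
     (case xs of [] \<Rightarrow> None
      | x # xs' \<Rightarrow> map_option (\<lambda>i. (pc + 1, r(i := x), xs', ys)) (target r a))"
| "ram_step (WRITE a) (pc, r, xs, ys) = map_option (\<lambda>v. (pc + 1, r, xs, ys @ [v])) (op_val r a)"
| "ram_step (JUMP l) (pc, r, xs, ys) = Some (l, r, xs, ys)"
| "ram_step (JGTZ l) (pc, r, xs, ys) = Some (if r 0 > 0 then l else pc + 1, r, xs, ys)"
| "ram_step (JZERO l) (pc, r, xs, ys) = Some (if r 0 = 0 then l else pc + 1, r, xs, ys)"
| "ram_step HALT s = None"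

fun ram_cost :: "instr \<Rightarrow> ram_state \<Rightarrow> nat" where
  "ram_cost (LOAD a) (pc, r, xs, ys) = op_cost r a"
| "ram_cost (STORE a) (pc, r, xs, ys) = len (r 0) + target_cost r a"
| "ram_cost (ADD a) (pc, r, xs, ys) = len (r 0) + op_cost r a"
| "ram_cost (SUB a) (pc, r, xs, ys) = len (r 0) + op_cost r a"
| "ram_cost (MULT a) (pc, r, xs, ys) = len (r 0) + op_cost r a"
| "ram_cost (DIV a) (pc, r, xs, ys) = len (r 0) + op_cost r a"
| "ram_cost (READ a) (pc, r, xs, ys) =
     (case xs of [] \<Rightarrow> 1 | x # xs' \<Rightarrow> len x) + target_cost r a"
| "ram_cost (WRITE a) (pc, r, xs, ys) = op_cost r a"
| "ram_cost (JUMP l) (pc, r, xs, ys) = 1"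
| "ram_cost (JGTZ l) (pc, r, xs, ys) = len (r 0)"
| "ram_cost (JZERO l) (pc, r, xs, ys) = len (r 0)"
| "ram_cost HALT s = 1"

text \<open>\<open>ram_halts M s ys T\<close>: from state \<open>s\<close> the program \<open>M\<close> reaches a \<open>HALT\<close> instruction with output
  \<open>ys\<close>, at total logarithmic cost \<open>T\<close>.\<close>

inductive ram_halts :: "instr list \<Rightarrow> ram_state \<Rightarrow> int list \<Rightarrow> nat \<Rightarrow> bool" for M where
  halt: "pc < length M \<Longrightarrow> M ! pc = HALT \<Longrightarrow> ram_halts M (pc, r, xs, ys) ys 1"
| step: "pc < length M \<Longrightarrow> ram_step (M ! pc) (pc, r, xs, ys) = Some s' \<Longrightarrow>
         ram_halts M s' zs T \<Longrightarrow>
         ram_halts M (pc, r, xs, ys) zs (ram_cost (M ! pc) (pc, r, xs, ys) + T)"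

definition ram_computes :: "instr list \<Rightarrow> int list \<Rightarrow> int list \<Rightarrow> nat \<Rightarrow> bool" where
  "ram_computes M xs ys T \<longleftrightarrow> ram_halts M (0, \<lambda>_. 0, xs, []) ys T"

text \<open>Polynomial time is a property of a family of functions. A member \<open>f : F_p^n \<rightarrow> F_p^t\<close> is explicit
  by means of \<open>M\<close> and \<open>q\<close> if \<open>M\<close>, given \<open>p\<close>, \<open>n\<close>, \<open>t\<close> and the coordinates of \<open>x\<close>, writes the coordinates of
  \<open>f x\<close> within time \<open>q\<close> of \<open>n + t + |p|\<close>, where \<open>|p|\<close> is the bit length of \<open>p\<close>. The family is explicit
  if one pair \<open>M\<close>, \<open>q\<close> serves all its members; \<open>M\<close> and \<open>q\<close> therefore have to be quantified outside
  the parameters. The size includes \<open>t\<close> because the output has \<open>t\<close> coordinates, and \<open>t\<close> is not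
  bounded in terms of \<open>n\<close> if \<open>\<epsilon>' \<ge> 1\<close>.\<close>

definition explicit_by ::
  "instr list \<Rightarrow> nat poly \<Rightarrow> nat \<Rightarrow> nat \<Rightarrow> nat \<Rightarrow> ((nat \<Rightarrow> int) \<Rightarrow> (nat \<Rightarrow> int)) \<Rightarrow> bool" where
  "explicit_by M q p n t f \<longleftrightarrow>
     (\<forall>x \<in> carrier (Fp_vec p n). \<exists>T \<le> poly q (n + t + floorlog 2 p).
        ram_computes M ([int p, int n, int t] @ map x [0..<n]) (map (f x) [0..<t]) T)"

text \<open>On the range of \<open>d\<close>: the theorem is false for arbitrary \<open>d > 0\<close>, whatever \<open>c\<close> is. The uniform
  distribution is \<open>(\<epsilon>, 1)\<close>-biased for every \<open>\<epsilon> \<ge> 0\<close>, and for \<open>p = 2\<close>, \<open>e = 1\<close>, \<open>\<epsilon>' = 1/4\<close>, \<open>d\<close> tiny the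
  inequality admits \<open>t = n + 1\<close>; then the output of \<open>f\<close> covers at most half of the codomain and is
  at distance at least 1/2 from uniform. Requiring \<open>t \<le> n\<close> does not help (take \<open>e = 2\<close> and the
  uniform distribution on a hyperplane). Hence \<open>1 \<le> d\<close> is assumed instead of \<open>0 < d\<close>; a source for
  some \<open>d < 1\<close> is also one for \<open>d = 1\<close>.\<close>

end

theory Submission
  imports Defs
begin

text \<open>With \<open>k = n div 4\<close> the extractor outputs the correlations
  \<open>f j x = (\<Sum>i<k. x i * x (k + i + j)) mod p\<close> for \<open>j < t\<close>, which need no field extension and hence no
  irreducible polynomial. For \<open>a \<noteq> 0\<close> the phase \<open>\<omega>\<close> to the power \<open>\<Sum>j. a j * f j x\<close> becomes linear in \<open>x\<close> once
  the first \<open>k\<close> coordinates are fixed to some \<open>z\<close>, and expanding the indicator of that event into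
  characters \<open>u\<close> writes the phase as \<open>p^(-k)\<close> times a unimodular combination of \<open>p^(2k)\<close> characters.
  These are pairwise distinct because multiplication by the nonzero polynomial \<open>a\<close> is injective.
  At most \<open>e\<close> of them are exceptional, so the phase has expectation at most
  \<open>e * p^(-k) + p^k * \<epsilon> \<le> 2 * d * e * p^(-k)\<close>. Parseval and Cauchy-Schwarz turn this into a statistical
  distance of at most \<open>p^(t/2)\<close> times this bound. Choosing \<open>k\<close> near \<open>n/2\<close> would not do, since then
  \<open>p^k * \<epsilon>\<close> is about \<open>d\<close>.\<close>

section \<open>Additive characters\<close>

text \<open>The standard additive character modulo \<open>p\<close>, lifted to all integers so that
  exponents are plain integer sums.\<close>

definition unit_exp :: "nat \<Rightarrow> int \<Rightarrow> complex" where
  "unit_exp p v = cis (2 * pi * real_of_int v / real p)"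

lemma unit_exp_0 [simp]: "unit_exp p 0 = 1"
  by (simp add: unit_exp_def)

lemma unit_exp_add: "unit_exp p (a + b) = unit_exp p a * unit_exp p b"
  by (simp add: unit_exp_def cis_mult add_divide_distrib ring_distribs)

lemma norm_unit_exp [simp]: "cmod (unit_exp p a) = 1"
  by (simp add: unit_exp_def)

lemma unit_exp_sum: "unit_exp p (\<Sum>i\<in>I. f i) = (\<Prod>i\<in>I. unit_exp p (f i))"
  by (induction I rule: infinite_finite_induct) (auto simp: unit_exp_add)

lemma unit_exp_of_nat_mult: "unit_exp p (int u * v) = unit_exp p v ^ u"
  by (induction u) (auto simp: unit_exp_add ring_distribs)

lemma cnj_unit_exp: "cnj (unit_exp p a) = unit_exp p (- a)"
  by (simp add: unit_exp_def cis_cnj)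

lemma unit_exp_eq_1_iff:
  assumes "0 < p"
  shows "unit_exp p v = 1 \<longleftrightarrow> int p dvd v"
proof
  assume "unit_exp p v = 1"
  then have "cos (2 * pi * v / p) = 1" by (simp add: unit_exp_def complex_eq_iff)
  then obtain N :: int where "2 * pi * v / p = N * 2 * pi"
    by (auto simp: cos_one_2pi_int)
  then have "real_of_int v = real_of_int (N * int p)" using assms by (simp add: field_simps)
  then have "v = N * int p" by linarith
  then show "int p dvd v" by simp
next
  assume "int p dvd v"
  then obtain N where "v = int p * N" by auto
  then show "unit_exp p v = 1"
    using assms cis_multiple_2pi[of "of_int N"] by (simp add: unit_exp_def mult.assoc)
qed

lemma unit_exp_cong:
  assumes "0 < p" "[a = b] (mod int p)"
  shows "unit_exp p a = unit_exp p b"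
proof -
  have "unit_exp p a = unit_exp p (a - b) * unit_exp p b" by (simp flip: unit_exp_add)
  moreover have "int p dvd a - b" using assms(2) by (simp add: cong_iff_dvd_diff)
  ultimately show ?thesis using assms(1) by (simp add: unit_exp_eq_1_iff)
qed

text \<open>A geometric sum whose ratio is a \<open>p\<close>-th root of unity, equal to 1 exactly
  when \<open>p\<close> divides \<open>v\<close>.\<close>

lemma sum_unit_exp:
  assumes "0 < p"
  shows "(\<Sum>u\<in>{0..int p - 1}. unit_exp p (u * v)) = (if int p dvd v then of_nat p else 0)"
proof -
  have "{0..int p - 1} = int ` {..<p}"
    by (auto simp: image_iff) (metis lessThan_iff nat_0_le nat_less_iff zle_diff1_eq)
  then have "(\<Sum>u\<in>{0..int p - 1}. unit_exp p (u * v)) = (\<Sum>u<p. unit_exp p v ^ u)"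
    by (simp add: sum.reindex unit_exp_of_nat_mult)
  also have "\<dots> = (if int p dvd v then of_nat p else 0)"
  proof (cases "int p dvd v")
    case False
    have "unit_exp p v ^ p = unit_exp p (int p * v)" by (simp add: unit_exp_of_nat_mult)
    also have "\<dots> = 1" using assms by (simp add: unit_exp_eq_1_iff)
    finally show ?thesis using False assms by (simp add: sum_gp_strict unit_exp_eq_1_iff)
  qed (use assms in \<open>simp add: unit_exp_eq_1_iff[THEN iffD2]\<close>)
  finally show ?thesis .
qed

section \<open>Vectors modulo \<open>p\<close> and their characters\<close>

definition vecs :: "nat \<Rightarrow> nat \<Rightarrow> (nat \<Rightarrow> int) set" where
  "vecs p n = (\<Pi>\<^sub>E i\<in>{..<n}. {0..int p - 1})"

lemma carrier_Fp_vec: "carrier (Fp_vec p n) = vecs p n"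
  by (simp add: Fp_vec_def vecs_def residue_ring_def)

lemma finite_vecs [simp]: "finite (vecs p n)"
  by (simp add: vecs_def finite_PiE)

lemma card_vecs: "card (vecs p n) = p ^ n"
  by (simp add: vecs_def card_PiE)

lemma vecs_range: "x \<in> vecs p n \<Longrightarrow> i < n \<Longrightarrow> 0 \<le> x i \<and> x i < int p"
  by (force simp: vecs_def PiE_def Pi_def)

lemma vecs_eqI:
  assumes "x \<in> vecs p n" "y \<in> vecs p n" "\<And>i. i < n \<Longrightarrow> int p dvd x i - y i"
  shows "x = y"
proof (rule PiE_ext)
  show "x \<in> (\<Pi>\<^sub>E i\<in>{..<n}. {0..int p - 1})" "y \<in> (\<Pi>\<^sub>E i\<in>{..<n}. {0..int p - 1})"
    using assms by (auto simp: vecs_def)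
  fix i assume "i \<in> {..<n}"
  then have i: "i < n" by simp
  have "x i mod int p = y i mod int p" using assms(3)[OF i] by (simp add: mod_eq_dvd_iff)
  then show "x i = y i" using vecs_range[OF assms(1) i] vecs_range[OF assms(2) i] by simp
qed

lemma sum_unit_exp_vecs:
  assumes "0 < p"
  shows "(\<Sum>u\<in>vecs p k. unit_exp p (\<Sum>i<k. u i * w i)) = (if \<forall>i<k. int p dvd w i then of_nat p ^ k else 0)"
proof -
  have "(\<Sum>u\<in>vecs p k. unit_exp p (\<Sum>i<k. u i * w i)) = (\<Prod>i<k. \<Sum>v\<in>{0..int p - 1}. unit_exp p (v * w i))"
    unfolding vecs_def unit_exp_sum by (subst prod_sum_PiE) auto
  also have "\<dots> = (\<Prod>i<k. if int p dvd w i then of_nat p else 0)"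
    using assms by (simp add: sum_unit_exp)
  also have "\<dots> = (if \<forall>i<k. int p dvd w i then of_nat p ^ k else 0)"
    by (auto simp: prod_zero_iff)
  finally show ?thesis .
qed

text \<open>Restricted to the group because \<open>characters\<close> contains extensional functions
  only.\<close>

definition chi :: "nat \<Rightarrow> nat \<Rightarrow> (nat \<Rightarrow> int) \<Rightarrow> (nat \<Rightarrow> int) \<Rightarrow> complex" where
  "chi p n u = restrict (\<lambda>x. unit_exp p (\<Sum>i<n. u i * x i)) (vecs p n)"

lemma chi_in_characters:
  assumes "0 < p"
  shows "chi p n u \<in> characters (Fp_vec p n)"
proof -
  have mult: "(\<lambda>i\<in>{..<n}. (x i + y i) mod int p) \<in> vecs p n" for x y
    using assms by (auto simp: vecs_def)
  have "unit_exp p (\<Sum>i<n. u i * ((x i + y i) mod int p)) = unit_exp p ((\<Sum>i<n. u i * x i) + (\<Sum>i<n. u i * y i))" for x y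
  proof (rule unit_exp_cong[OF assms])
    have "[(\<Sum>i<n. u i * ((x i + y i) mod int p)) = (\<Sum>i<n. u i * (x i + y i))] (mod int p)"
      by (intro cong_sum cong_mult) (auto simp: cong_def)
    then show "[(\<Sum>i<n. u i * ((x i + y i) mod int p)) = (\<Sum>i<n. u i * x i) + (\<Sum>i<n. u i * y i)] (mod int p)"
      by (simp add: sum.distrib ring_distribs)
  qed
  moreover have "unit_exp p a \<noteq> 0" for a using norm_unit_exp[of p a] by (metis norm_zero zero_neq_one)
  ultimately have "chi p n u \<in> hom (Fp_vec p n) complex_units"
    using mult by (auto intro!: homI simp: carrier_Fp_vec complex_units_def chi_def unit_exp_add)
      (simp add: Fp_vec_def residue_ring_def unit_exp_add mult)+
  then show ?thesis by (simp add: characters_def carrier_Fp_vec chi_def)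
qed

text \<open>Evaluation at the \<open>i\<close>-th unit vector recovers \<open>u i\<close> modulo
  \<open>p\<close>, so coefficient vectors that differ modulo \<open>p\<close> give characters that
  count separately.\<close>

lemma chi_eqD:
  assumes "1 < p" "chi p n u = chi p n v" "i < n"
  shows "int p dvd u i - v i"
proof -
  let ?x = "\<lambda>j\<in>{..<n}. if j = i then 1 else 0 :: int"
  have x: "?x \<in> vecs p n" using assms(1) by (auto simp: vecs_def)
  have s: "(\<Sum>j<n. w j * ?x j) = w i" for w
  proof -
    have "(\<Sum>j<n. w j * ?x j) = (\<Sum>j<n. if j = i then w j else 0)" by (intro sum.cong) auto
    then show ?thesis using assms(3) by simp
  qed
  have "chi p n w ?x = unit_exp p (w i)" for w
    by (simp only: chi_def restrict_apply'[OF x] s)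
  then have "unit_exp p (u i) = unit_exp p (v i)" using assms(2) by metis
  then have "unit_exp p (u i - v i) = unit_exp p (v i) * unit_exp p (- v i)"
    using unit_exp_add[of p "u i" "- v i"] by simp
  then show ?thesis using assms(1) by (simp add: unit_exp_eq_1_iff flip: unit_exp_add)
qed

section \<open>The correlation extractor on biased sources\<close>

text \<open>The linear form whose coefficients are \<open>u\<close> on the first \<open>k\<close> coordinates and the convolution
  of \<open>z\<close> and \<open>a\<close> on the following ones.\<close>

definition conv_coeff ::
  "nat \<Rightarrow> nat \<Rightarrow> (nat \<Rightarrow> int) \<Rightarrow> (nat \<Rightarrow> int) \<Rightarrow> (nat \<Rightarrow> int) \<Rightarrow> nat \<Rightarrow> int" where
  "conv_coeff k t a z u l = (if l < k then u l else 0) +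
     (\<Sum>i<k. \<Sum>j<t. if l = k + i + j then z i * a j else 0)"

lemma conv_coeff_apply:
  assumes "2 * k + t \<le> n"
  shows "(\<Sum>l<n. conv_coeff k t a z u l * x l) =
    (\<Sum>i<k. u i * x i) + (\<Sum>i<k. \<Sum>j<t. z i * a j * x (k + i + j))"
proof -
  have "(\<Sum>l<n. (if l < k then u l else 0) * x l) = (\<Sum>l<k. u l * x l)"
    using assms by (intro sum.mono_neutral_cong_right) auto
  moreover have "(\<Sum>l<n. (\<Sum>i<k. \<Sum>j<t. if l = k + i + j then z i * a j else 0) * x l) =
      (\<Sum>i<k. \<Sum>j<t. \<Sum>l<n. if l = k + i + j then z i * a j * x l else 0)"
  proof -
    have "(\<Sum>l<n. (\<Sum>i<k. \<Sum>j<t. if l = k + i + j then z i * a j else 0) * x l) =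
        (\<Sum>l<n. \<Sum>i<k. \<Sum>j<t. if l = k + i + j then z i * a j * x l else 0)"
      unfolding sum_distrib_right by (intro sum.cong refl) auto
    also have "\<dots> = (\<Sum>i<k. \<Sum>l<n. \<Sum>j<t. if l = k + i + j then z i * a j * x l else 0)"
      by (rule sum.swap)
    also have "\<dots> = (\<Sum>i<k. \<Sum>j<t. \<Sum>l<n. if l = k + i + j then z i * a j * x l else 0)"
      by (intro sum.cong refl sum.swap)
    finally show ?thesis .
  qed
  \<comment> \<open>All indices \<open>k + i + j\<close> lie below \<open>2 * k + t\<close>, hence
    below \<open>n\<close>, so the sum over \<open>l\<close> meets each of them exactly
    once.\<close>
  moreover have "\<dots> = (\<Sum>i<k. \<Sum>j<t. z i * a j * x (k + i + j))"
    using assms by (intro sum.cong refl) (auto simp: sum.delta)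
  ultimately show ?thesis
    by (simp add: conv_coeff_def ring_distribs sum.distrib)
qed

text \<open>The first \<open>k\<close> coefficients return \<open>u\<close>. The others are those of
  the product of the polynomials \<open>z\<close> and \<open>a\<close> modulo \<open>p\<close>;
  there are no zero divisors, so \<open>z\<close> is determined as well.\<close>

lemma conv_coeff_inj:
  assumes "prime p" "2 * k + t \<le> n" "j < t" "\<not> int p dvd a j"
  shows "inj_on (\<lambda>(z, u). chi p n (conv_coeff k t a z u)) (vecs p k \<times> vecs p k)"
proof (rule inj_onI; clarsimp)
  fix z u z' u'
  assume V: "z \<in> vecs p k" "u \<in> vecs p k" "z' \<in> vecs p k" "u' \<in> vecs p k"
    and eq: "chi p n (conv_coeff k t a z u) = chi p n (conv_coeff k t a z' u')"
  have D: "int p dvd conv_coeff k t a z u l - conv_coeff k t a z' u' l" if "l < n" for l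
    using chi_eqD[OF _ eq that] prime_gt_1_nat[OF assms(1)] by simp
  have pr: "prime (int p)" using assms(1) by simp
  have "u = u'"
  proof (rule vecs_eqI[OF V(2,4)])
    fix i assume i: "i < k"
    then have "conv_coeff k t a w v i = v i" for w v
      by (auto simp: conv_coeff_def intro!: sum.neutral)
    then show "int p dvd u i - u' i" using D[of i] i assms(2) by simp
  qed
  moreover have "z = z'"
  proof (rule ccontr)
    assume "z \<noteq> z'"
    then obtain i where "i < k" "\<not> int p dvd z i - z' i"
      using vecs_eqI[OF V(1,3)] by auto
    define w where "w i = z i - z' i" for i
    define P where "P i \<longleftrightarrow> i < k \<and> \<not> int p dvd w i" for i
    define Q where "Q j \<longleftrightarrow> j < t \<and> \<not> int p dvd a j" for j
    \<comment> \<open>The lowest degrees at which \<open>w\<close> and \<open>a\<close> do not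
      vanish modulo \<open>p\<close>; their product has a nonzero coefficient in degree
      \<open>i0 + j0\<close>.\<close>
    define i0 where "i0 = (LEAST i. P i)"
    define j0 where "j0 = (LEAST j. Q j)"
    have "P i" using \<open>i < k\<close> \<open>\<not> int p dvd z i - z' i\<close> by (simp add: P_def w_def)
    then have i0: "P i0" "\<And>i. i < i0 \<Longrightarrow> \<not> P i"
      unfolding i0_def by (auto intro: LeastI dest: not_less_Least)
    have "Q j" using assms by (simp add: Q_def)
    then have j0: "Q j0" "\<And>j. j < j0 \<Longrightarrow> \<not> Q j"
      unfolding j0_def by (auto intro: LeastI dest: not_less_Least)
    let ?l = "k + i0 + j0"
    let ?F = "\<lambda>(i, j). if ?l = k + i + j then w i * a j else 0"
    have "?l < n" using i0(1) j0(1) assms(2) by (auto simp: P_def Q_def)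
    from D[OF this] have "int p dvd (\<Sum>i<k. \<Sum>j<t. if ?l = k + i + j then z i * a j else 0) -
        (\<Sum>i<k. \<Sum>j<t. if ?l = k + i + j then z' i * a j else 0)"
      by (simp add: conv_coeff_def)
    also have "\<dots> = (\<Sum>i<k. \<Sum>j<t. if ?l = k + i + j then w i * a j else 0)"
      unfolding sum_subtractf[symmetric] by (intro sum.cong refl) (simp add: w_def algebra_simps)
    also have "\<dots> = sum ?F ({..<k} \<times> {..<t})" by (simp add: sum.cartesian_product)
    also have "\<dots> = ?F (i0, j0) + sum ?F ({..<k} \<times> {..<t} - {(i0, j0)})"
      using i0(1) j0(1) by (intro sum.remove) (auto simp: P_def Q_def)
    finally have "int p dvd w i0 * a j0 + sum ?F ({..<k} \<times> {..<t} - {(i0, j0)})" by simp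
    moreover have "int p dvd sum ?F ({..<k} \<times> {..<t} - {(i0, j0)})"
    proof (rule dvd_sum)
      fix q assume "q \<in> {..<k} \<times> {..<t} - {(i0, j0)}"
      then obtain i j where q: "q = (i, j)" and ij: "i < k" "j < t" "(i, j) \<noteq> (i0, j0)" by auto
      show "int p dvd ?F q"
      proof (cases "?l = k + i + j")
        case True
        \<comment> \<open>A different pair with the same index sum has one index below its minimum,
          where the coefficient is divisible by \<open>p\<close>.\<close>
        with ij have "i < i0 \<or> j < j0" by auto
        then have "int p dvd w i \<or> int p dvd a j"
          using i0(2)[of i] j0(2)[of j] ij by (auto simp: P_def Q_def)
        then show ?thesis unfolding q by auto
      qed (simp add: q)
    qed
    ultimately have "int p dvd w i0 * a j0" by (simp add: dvd_add_left_iff)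
    then show False using pr i0(1) j0(1) by (auto simp: P_def Q_def prime_dvd_mult_iff)
  qed
  ultimately show "z = z' \<and> u = u'" by simp
qed


text \<open>Summing over \<open>u\<close> first gives, by orthogonality, \<open>p^k\<close> times
  the indicator that \<open>z\<close> agrees with the first \<open>k\<close> coordinates of
  \<open>x\<close>; for this \<open>z\<close> the linear phase is the bilinear one.\<close>

lemma unit_exp_conv_expansion:
  assumes "0 < p" "2 * k + t \<le> n" "x \<in> vecs p n"
  shows "of_nat p ^ k * unit_exp p (\<Sum>i<k. \<Sum>j<t. x i * a j * x (k + i + j)) =
    (\<Sum>(z, u)\<in>vecs p k \<times> vecs p k. unit_exp p (- (\<Sum>i<k. u i * z i)) * chi p n (conv_coeff k t a z u) x)"
proof -
  let ?B = "\<lambda>z. \<Sum>i<k. \<Sum>j<t. z i * a j * x (k + i + j)"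
  let ?x = "restrict x {..<k}"
  have x: "?x \<in> vecs p k" using assms by (auto simp: vecs_def PiE_def Pi_def)
  have dvd: "(\<forall>i<k. int p dvd x i - z i) \<longleftrightarrow> z = ?x" if "z \<in> vecs p k" for z
    using vecs_eqI[OF x that] by auto
  have "(\<Sum>(z, u)\<in>vecs p k \<times> vecs p k. unit_exp p (- (\<Sum>i<k. u i * z i)) * chi p n (conv_coeff k t a z u) x) =
     (\<Sum>z\<in>vecs p k. \<Sum>u\<in>vecs p k. unit_exp p (- (\<Sum>i<k. u i * z i)) * chi p n (conv_coeff k t a z u) x)"
    by (simp add: sum.cartesian_product)
  also have "\<dots> = (\<Sum>z\<in>vecs p k. \<Sum>u\<in>vecs p k. unit_exp p (?B z) * unit_exp p (\<Sum>i<k. u i * (x i - z i)))"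
  proof (intro sum.cong refl)
    fix z u :: "nat \<Rightarrow> int"
    have "- (\<Sum>i<k. u i * z i) + (\<Sum>l<n. conv_coeff k t a z u l * x l) =
        ?B z + (\<Sum>i<k. u i * (x i - z i))"
      unfolding conv_coeff_apply[OF assms(2)] right_diff_distrib sum_subtractf by simp
    then show "unit_exp p (- (\<Sum>i<k. u i * z i)) * chi p n (conv_coeff k t a z u) x =
        unit_exp p (?B z) * unit_exp p (\<Sum>i<k. u i * (x i - z i))"
      using assms(3) by (simp add: chi_def flip: unit_exp_add)
  qed
  also have "\<dots> = (\<Sum>z\<in>vecs p k. unit_exp p (?B z) * (if z = ?x then of_nat p ^ k else 0))"
    using assms(1) by (intro sum.cong refl) (simp add: sum_unit_exp_vecs dvd flip: sum_distrib_left)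
  also have "\<dots> = unit_exp p (?B ?x) * of_nat p ^ k"
    using x by (simp add: if_distrib[of "\<lambda>y. _ * y"] sum.delta cong: if_cong)
  also have "?B ?x = ?B x" by (intro sum.cong refl) simp
  finally show ?thesis by simp
qed

section \<open>Bias of the bilinear phase\<close>

lemma norm_expectation_le_1:
  fixes f :: "'a \<Rightarrow> complex"
  assumes "finite (set_pmf D)" "\<And>x. x \<in> set_pmf D \<Longrightarrow> cmod (f x) \<le> 1"
  shows "cmod (measure_pmf.expectation D f) \<le> 1"
proof -
  have "cmod (measure_pmf.expectation D f) \<le> measure_pmf.expectation D (\<lambda>x. cmod (f x))"
    by (rule integral_norm_bound)
  also have "\<dots> \<le> measure_pmf.expectation D (\<lambda>_. 1)"
    using assms by (intro integral_mono_AE integrable_measure_pmf_finite) (auto simp: AE_measure_pmf_iff)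
  finally show ?thesis by simp
qed

text \<open>By injectivity at most \<open>e\<close> of the \<open>p^(2 * k)\<close> characters in
  the expansion are exceptional; these are bounded by 1, the others by \<open>\<epsilon>\<close>.
  Division by \<open>p^k\<close> gives the two terms.\<close>

lemma expectation_conv_le:
  assumes "prime p" "2 * k + t \<le> n" "j < t" "\<not> int p dvd a j"
    and D: "D \<in> biased_sources (Fp_vec p n) \<epsilon> e" and \<epsilon>: "0 \<le> \<epsilon>"
  shows "cmod (measure_pmf.expectation D (\<lambda>x. unit_exp p (\<Sum>i<k. \<Sum>j<t. x i * a j * x (k + i + j))))
    \<le> real e / real p ^ k + real p ^ k * \<epsilon>"
proof -
  have p: "0 < p" using assms(1) prime_gt_0_nat by blast
  let ?V = "vecs p k \<times> vecs p k"
  let ?\<chi> = "\<lambda>(z, u). chi p n (conv_coeff k t a z u)"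
  let ?c = "\<lambda>(z, u). unit_exp p (- (\<Sum>i<k. u i * z i))"
  let ?g = "\<lambda>x. unit_exp p (\<Sum>i<k. \<Sum>j<t. x i * a j * x (k + i + j))"
  let ?E = "measure_pmf.expectation D"
  have supp: "set_pmf D \<subseteq> vecs p n" and bias: "biased (Fp_vec p n) \<epsilon> e D"
    using D by (auto simp: biased_sources_def carrier_Fp_vec)
  have fin: "finite (set_pmf D)" by (rule finite_subset[OF supp]) simp
  have int: "integrable (measure_pmf D) f" for f :: "_ \<Rightarrow> complex"
    by (rule integrable_measure_pmf_finite[OF fin])
  from bias obtain S where S: "finite S" "card S \<le> e"
    "\<And>\<psi>. \<psi> \<in> characters (Fp_vec p n) - S \<Longrightarrow> cmod (?E \<psi>) \<le> \<epsilon>"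
    unfolding biased_def by blast
  define B where "B = {q \<in> ?V. ?\<chi> q \<in> S}"
  have inj: "inj_on ?\<chi> ?V" by (rule conv_coeff_inj[OF assms(1-3), of a, OF assms(4)])
  have "card B \<le> card S"
    by (rule card_inj_on_le[of ?\<chi>]) (use inj S(1) in \<open>auto simp: B_def inj_on_def\<close>)
  then have B: "card B \<le> e" using S(2) by simp
  have le: "cmod (?E (?\<chi> q)) \<le> of_bool (q \<in> B) + \<epsilon>" if "q \<in> ?V" for q
  proof (cases "q \<in> B")
    case True
    have "cmod (?E (?\<chi> q)) \<le> 1"
      using supp by (intro norm_expectation_le_1[OF fin]) (auto simp: chi_def split: prod.splits)
    with True \<epsilon> show ?thesis by simp
  next
    case False
    have "?\<chi> q \<in> characters (Fp_vec p n)" using chi_in_characters[OF p] by (auto split: prod.splits)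
    with False that S(3)[of "?\<chi> q"] show ?thesis by (simp add: B_def)
  qed
  have "of_nat p ^ k * ?E ?g = ?E (\<lambda>x. of_nat p ^ k * ?g x)" by simp
  \<comment> \<open>The expansion holds only on \<open>vecs p n\<close>, so the integrands are
    equated only on the support of \<open>D\<close>.\<close>
  also have "\<dots> = ?E (\<lambda>x. \<Sum>q\<in>?V. ?c q * ?\<chi> q x)"
  proof (intro integral_cong_AE)
    show "AE x in measure_pmf D. of_nat p ^ k * ?g x = (\<Sum>q\<in>?V. ?c q * ?\<chi> q x)"
      unfolding AE_measure_pmf_iff
    proof
      fix x assume "x \<in> set_pmf D"
      with supp have "x \<in> vecs p n" by auto
      from unit_exp_conv_expansion[OF p assms(2) this, of a]
      show "of_nat p ^ k * ?g x = (\<Sum>q\<in>?V. ?c q * ?\<chi> q x)" by (simp add: case_prod_unfold)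
    qed
  qed auto
  also have "\<dots> = (\<Sum>q\<in>?V. ?c q * ?E (?\<chi> q))" by (simp add: int)
  finally have "cmod (of_nat p ^ k * ?E ?g) = cmod (\<Sum>q\<in>?V. ?c q * ?E (?\<chi> q))"
    by (rule arg_cong)
  then have "real p ^ k * cmod (?E ?g) = cmod (\<Sum>q\<in>?V. ?c q * ?E (?\<chi> q))"
    unfolding norm_mult norm_power norm_of_nat .
  also have "\<dots> \<le> (\<Sum>q\<in>?V. cmod (?E (?\<chi> q)))"
    by (rule sum_norm_le) (auto simp: norm_mult)
  also have "\<dots> \<le> (\<Sum>q\<in>?V. of_bool (q \<in> B) + \<epsilon>)" by (rule sum_mono) (rule le)
  also have "\<dots> = real (card B) + real (card ?V) * \<epsilon>"
  proof -
    have "B \<subseteq> ?V" by (auto simp: B_def)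
    then have "(\<Sum>q\<in>?V. of_bool (q \<in> B) :: real) = real (card B)"
      by (simp add: Int_absorb1)
    then show ?thesis by (simp add: sum.distrib)
  qed
  also have "\<dots> \<le> real e + real p ^ k * (real p ^ k * \<epsilon>)"
    using B by (simp add: card_cartesian_product card_vecs)
  finally show ?thesis using p by (simp add: field_simps)
qed

section \<open>Statistical distance from character sums\<close>

text \<open>Vazirani's XOR lemma. \<open>h\<close> is the deviation from the uniform density and
  \<open>H\<close> its Fourier transform. Parseval bounds the sum of the squares of \<open>h\<close>
  by the square of \<open>\<delta>\<close>, and Cauchy-Schwarz passes to absolute values at the cost
  of \<open>sqrt (p^t)\<close>.\<close>

lemma stat_dist_le_characters:
  assumes p: "0 < p" and supp: "set_pmf P \<subseteq> vecs p t" and \<delta>: "0 \<le> \<delta>"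
    and bias: "\<And>a j. j < t \<Longrightarrow> \<not> int p dvd a j \<Longrightarrow>
      cmod (measure_pmf.expectation P (\<lambda>y. unit_exp p (\<Sum>i<t. a i * y i))) \<le> \<delta>"
  shows "stat_dist P (pmf_of_set (vecs p t)) \<le> sqrt (real p ^ t) * \<delta>"
proof -
  let ?V = "vecs p t"
  define h where "h y = pmf P y - 1 / real p ^ t" for y
  define H where "H a = (\<Sum>y\<in>?V. of_real (h y) * unit_exp p (\<Sum>i<t. a i * y i))" for a
  have ne: "?V \<noteq> {}" using card_vecs[of p t] p by (metis card.empty power_not_zero less_numeral_extra(3))
  \<comment> \<open>If \<open>p\<close> divides every \<open>a i\<close>, the expectation and the
    uniform average are both 1 and \<open>H a\<close> is 0. Otherwise the uniform average vanishes
    and \<open>bias\<close> applies.\<close>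
  have H_le: "cmod (H a) \<le> \<delta>" for a
  proof -
    have E: "measure_pmf.expectation P f = (\<Sum>y\<in>?V. of_real (pmf P y) * f y)" for f :: "_ \<Rightarrow> complex"
      using supp by (subst integral_measure_pmf[of ?V]) (auto simp: scaleR_conv_of_real)
    have "H a = measure_pmf.expectation P (\<lambda>y. unit_exp p (\<Sum>i<t. a i * y i)) -
        (\<Sum>y\<in>?V. unit_exp p (\<Sum>i<t. a i * y i)) / of_nat p ^ t"
      by (simp add: H_def E h_def algebra_simps sum_subtractf sum_divide_distrib)
    moreover have "(\<Sum>y\<in>?V. unit_exp p (\<Sum>i<t. a i * y i)) =
        (if \<forall>i<t. int p dvd a i then of_nat p ^ t else 0)"
      using sum_unit_exp_vecs[OF p, where k = t and w = a] by (simp add: mult.commute)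
    moreover have "measure_pmf.expectation P (\<lambda>y. unit_exp p (\<Sum>i<t. a i * y i)) = 1"
      if "\<forall>i<t. int p dvd a i"
    proof -
      have "unit_exp p (\<Sum>i<t. a i * y i) = 1" for y
        using that p by (auto simp: unit_exp_eq_1_iff intro!: dvd_sum)
      then show ?thesis by simp
    qed
    ultimately show ?thesis using bias[of _ a] p \<delta> by (cases "\<forall>i<t. int p dvd a i") auto
  qed
  have parseval: "(\<Sum>a\<in>?V. (cmod (H a))\<^sup>2) = real p ^ t * (\<Sum>y\<in>?V. (h y)\<^sup>2)"
  proof -
    have "complex_of_real (\<Sum>a\<in>?V. (cmod (H a))\<^sup>2) = (\<Sum>a\<in>?V. H a * cnj (H a))"
      by (simp only: of_real_sum complex_norm_square)
    also have "\<dots> = (\<Sum>a\<in>?V. \<Sum>y\<in>?V. \<Sum>y'\<in>?V. of_real (h y * h y') * unit_exp p (\<Sum>i<t. a i * (y i - y' i)))"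
      unfolding H_def cnj_sum sum_product
    proof (intro sum.cong refl)
      fix a y y' :: "nat \<Rightarrow> int"
      have "(\<Sum>i<t. a i * y i) + - (\<Sum>i<t. a i * y' i) = (\<Sum>i<t. a i * (y i - y' i))"
        by (simp add: right_diff_distrib sum_subtractf)
      then have "unit_exp p (\<Sum>i<t. a i * y i) * cnj (unit_exp p (\<Sum>i<t. a i * y' i)) = unit_exp p (\<Sum>i<t. a i * (y i - y' i))"
        unfolding cnj_unit_exp unit_exp_add[symmetric] by simp
      then show "of_real (h y) * unit_exp p (\<Sum>i<t. a i * y i) * cnj (of_real (h y') * unit_exp p (\<Sum>i<t. a i * y' i)) =
          of_real (h y * h y') * unit_exp p (\<Sum>i<t. a i * (y i - y' i))"
        by (simp add: mult.assoc mult.left_commute)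
    qed
    also have "\<dots> = (\<Sum>y\<in>?V. \<Sum>y'\<in>?V. of_real (h y * h y') * (\<Sum>a\<in>?V. unit_exp p (\<Sum>i<t. a i * (y i - y' i))))"
    proof -
      have "(\<Sum>a\<in>?V. \<Sum>y\<in>?V. \<Sum>y'\<in>?V. F a y y') = (\<Sum>y\<in>?V. \<Sum>y'\<in>?V. \<Sum>a\<in>?V. F a y y')"
        for F :: "_ \<Rightarrow> _ \<Rightarrow> _ \<Rightarrow> complex"
        by (subst sum.swap) (intro sum.cong refl sum.swap)
      then show ?thesis by (simp only: sum_distrib_left)
    qed
    \<comment> \<open>Orthogonality in \<open>a\<close> leaves only the diagonal, since congruent
      elements of \<open>vecs p t\<close> are equal.\<close>
    also have "\<dots> = (\<Sum>y\<in>?V. \<Sum>y'\<in>?V. if y' = y then of_real ((h y)\<^sup>2) * of_nat p ^ t else 0)"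
      using vecs_eqI[where p = p and n = t] by (intro sum.cong refl) (auto simp: sum_unit_exp_vecs[OF p] power2_eq_square)
    also have "\<dots> = complex_of_real (real p ^ t * (\<Sum>y\<in>?V. (h y)\<^sup>2))"
      by (simp add: sum_distrib_left mult.commute)
    finally show ?thesis using of_real_eq_iff by blast
  qed
  have "real p ^ t * (\<Sum>y\<in>?V. (h y)\<^sup>2) \<le> (\<Sum>a\<in>?V. \<delta>\<^sup>2)"
    unfolding parseval[symmetric] by (intro sum_mono power_mono H_le) auto
  also have "\<dots> = real p ^ t * \<delta>\<^sup>2" by (simp add: card_vecs)
  finally have h2: "(\<Sum>y\<in>?V. (h y)\<^sup>2) \<le> \<delta>\<^sup>2" using p by simp
  have "(\<Sum>y\<in>?V. \<bar>h y\<bar>) \<le> sqrt (real p ^ t) * \<delta>"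
  proof -
    have "(\<Sum>y\<in>?V. 1 * \<bar>h y\<bar>)\<^sup>2 \<le> (\<Sum>y\<in>?V. 1\<^sup>2) * (\<Sum>y\<in>?V. \<bar>h y\<bar>\<^sup>2)"
      by (rule Cauchy_Schwarz_ineq_sum)
    also have "\<dots> \<le> real p ^ t * \<delta>\<^sup>2" using h2 by (simp add: card_vecs mult_left_mono)
    also have "\<dots> = (sqrt (real p ^ t) * \<delta>)\<^sup>2" by (simp add: power_mult_distrib)
    finally show ?thesis using \<delta> by (intro power2_le_imp_le[of "sum _ _"]) auto
  qed
  moreover have "\<bar>measure_pmf.prob P S - measure_pmf.prob (pmf_of_set ?V) S\<bar> \<le> (\<Sum>y\<in>?V. \<bar>h y\<bar>)" for S
  proof -
    have pr: "measure_pmf.prob Q S = (\<Sum>y\<in>S \<inter> ?V. pmf Q y)" if "set_pmf Q \<subseteq> ?V" for Q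
    proof -
      have "measure_pmf.prob Q S = measure_pmf.prob Q (S \<inter> ?V)"
        using that by (intro measure_pmf.finite_measure_eq_AE) (auto simp: AE_measure_pmf_iff)
      then show ?thesis by (simp add: measure_measure_pmf_finite)
    qed
    have "measure_pmf.prob P S - measure_pmf.prob (pmf_of_set ?V) S = (\<Sum>y\<in>S \<inter> ?V. h y)"
      using supp ne by (simp add: pr h_def sum_subtractf card_vecs)
    also have "\<bar>\<dots>\<bar> \<le> (\<Sum>y\<in>S \<inter> ?V. \<bar>h y\<bar>)" by (rule sum_abs)
    also have "\<dots> \<le> (\<Sum>y\<in>?V. \<bar>h y\<bar>)" by (intro sum_mono2) auto
    finally show ?thesis .
  qed
  ultimately show ?thesis unfolding stat_dist_def by (intro cSUP_least) (auto intro: order_trans)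
qed

text \<open>Settles the case \<open>\<epsilon>' \<ge> 1\<close>, where \<open>t\<close> may exceed
  \<open>n\<close>.\<close>

lemma stat_dist_le_1: "stat_dist P Q \<le> 1"
  unfolding stat_dist_def
proof (rule cSUP_least)
  fix S
  show "\<bar>measure_pmf.prob P S - measure_pmf.prob Q S\<bar> \<le> 1"
    using measure_pmf.prob_le_1[of P S] measure_pmf.prob_le_1[of Q S]
      measure_nonneg[of "measure_pmf P" S] measure_nonneg[of "measure_pmf Q" S] by linarith
qed simp


section \<open>Runs of random access machines\<close>

text \<open>A common bound \<open>m\<close> on every length that enters the logarithmic cost reduces
  the time analysis to counting steps.\<close>

fun operand_small :: "nat \<Rightarrow> regs \<Rightarrow> operand \<Rightarrow> bool" where
  "operand_small m r (Imm i) \<longleftrightarrow> len i \<le> m"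
| "operand_small m r (Reg i) \<longleftrightarrow> len (int i) \<le> m \<and> len (r i) \<le> m"
| "operand_small m r (Ind i) \<longleftrightarrow>
     len (int i) \<le> m \<and> len (r i) \<le> m \<and> len (r (nat (r i))) \<le> m"

fun target_small :: "nat \<Rightarrow> regs \<Rightarrow> operand \<Rightarrow> bool" where
  "target_small m r (Imm i) \<longleftrightarrow> len i \<le> m"
| "target_small m r (Reg i) \<longleftrightarrow> len (int i) \<le> m"
| "target_small m r (Ind i) \<longleftrightarrow> len (int i) \<le> m \<and> len (r i) \<le> m"

fun step_small :: "nat \<Rightarrow> instr \<Rightarrow> ram_state \<Rightarrow> bool" where
  "step_small m (LOAD a) (pc, r, xs, ys) \<longleftrightarrow> operand_small m r a"
| "step_small m (STORE a) (pc, r, xs, ys) \<longleftrightarrow> len (r 0) \<le> m \<and> target_small m r a"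
| "step_small m (ADD a) (pc, r, xs, ys) \<longleftrightarrow> len (r 0) \<le> m \<and> operand_small m r a"
| "step_small m (SUB a) (pc, r, xs, ys) \<longleftrightarrow> len (r 0) \<le> m \<and> operand_small m r a"
| "step_small m (MULT a) (pc, r, xs, ys) \<longleftrightarrow> len (r 0) \<le> m \<and> operand_small m r a"
| "step_small m (DIV a) (pc, r, xs, ys) \<longleftrightarrow> len (r 0) \<le> m \<and> operand_small m r a"
| "step_small m (READ a) (pc, r, xs, ys) \<longleftrightarrow>
     xs \<noteq> [] \<and> len (hd xs) \<le> m \<and> target_small m r a"
| "step_small m (WRITE a) (pc, r, xs, ys) \<longleftrightarrow> operand_small m r a"
| "step_small m (JUMP l) (pc, r, xs, ys) \<longleftrightarrow> 1 \<le> m"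
| "step_small m (JGTZ l) (pc, r, xs, ys) \<longleftrightarrow> len (r 0) \<le> m"
| "step_small m (JZERO l) (pc, r, xs, ys) \<longleftrightarrow> len (r 0) \<le> m"
| "step_small m HALT s \<longleftrightarrow> 1 \<le> m"

lemma op_cost_le_if_small: "operand_small m r a \<Longrightarrow> op_cost r a \<le> 3 * m"
  by (cases a) auto

lemma target_cost_le_if_small: "target_small m r a \<Longrightarrow> target_cost r a \<le> 2 * m"
  by (cases a) auto

text \<open>The worst instruction pays for the accumulator and the three lengths of an indirect
  operand.\<close>

lemma ram_cost_le_if_small: "step_small m i s \<Longrightarrow> ram_cost i s \<le> 4 * m"
  by (cases "(m, i, s)" rule: step_small.cases)
     (auto dest!: op_cost_le_if_small target_cost_le_if_small split: list.splits)

text \<open>The step count is an explicit argument so that straight-line code is run by the simplifier.\<close>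

fun run :: "instr list \<Rightarrow> nat \<Rightarrow> nat \<Rightarrow> ram_state \<Rightarrow> ram_state option" where
  "run M m 0 s = Some s"
| "run M m (Suc N) (pc, r, xs, ys) =
     (if pc < length M \<and> step_small m (M ! pc) (pc, r, xs, ys)
      then Option.bind (ram_step (M ! pc) (pc, r, xs, ys)) (run M m N) else None)"

lemma run_numeral:
  "run M m (numeral w) (pc, r, xs, ys) =
     (if pc < length M \<and> step_small m (M ! pc) (pc, r, xs, ys)
      then Option.bind (ram_step (M ! pc) (pc, r, xs, ys)) (run M m (pred_numeral w)) else None)"
  by (simp add: numeral_eq_Suc)

lemma run_add:
  "run M m N s = Some s' \<Longrightarrow> run M m N' s' = Some s'' \<Longrightarrow> run M m (N + N') s = Some s''"
  by (induction M m N s rule: run.induct) (auto split: if_splits bind_splits)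

text \<open>A result \<open>Some\<close> certifies that every step passed \<open>step_small\<close>
  and so costs at most \<open>4 * m\<close>; the extra 1 pays for \<open>HALT\<close>.\<close>

lemma ram_halts_if_run:
  assumes "run M m N s = Some (pc, r, xs, ys)" "pc < length M" "M ! pc = HALT"
  shows "\<exists>T \<le> 4 * m * N + 1. ram_halts M s ys T"
  using assms(1)
proof (induction N arbitrary: s)
  case 0
  then show ?case using ram_halts.halt[OF assms(2,3)] by auto
next
  case (Suc N)
  obtain pc0 r0 xs0 ys0 where s: "s = (pc0, r0, xs0, ys0)" by (cases s)
  with Suc.prems obtain s' where *: "pc0 < length M" "step_small m (M ! pc0) s"
    "ram_step (M ! pc0) s = Some s'" "run M m N s' = Some (pc, r, xs, ys)"
    by (auto split: if_splits bind_splits)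
  from Suc.IH[OF *(4)] obtain T where T: "T \<le> 4 * m * N + 1" "ram_halts M s' ys T" by auto
  have "ram_halts M s ys (ram_cost (M ! pc0) s + T)"
    using ram_halts.step[OF *(1)] *(3) T(2) s by auto
  moreover have "ram_cost (M ! pc0) s + T \<le> 4 * m * Suc N + 1"
    using ram_cost_le_if_small[OF *(2)] T(1) by simp
  ultimately show ?case by blast
qed

lemma len_le:
  assumes "0 < m" "\<bar>v\<bar> < 2 ^ m"
  shows "len v \<le> m"
proof -
  have "nat \<bar>v\<bar> < 2 ^ m" using assms(2) by (simp add: nat_less_iff)
  then show ?thesis using assms(1) by (simp add: len_def floorlog_leI)
qed

section \<open>A program for the correlations\<close>

text \<open>Registers: 1 holds \<open>p\<close>, 2 holds \<open>n\<close>, 3 the number of outputs still to be written, 4 holds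
  \<open>n div 4\<close>, 5 points to \<open>x i\<close>, 6 to \<open>x (n div 4 + j)\<close>, 7 to \<open>x (n div 4 + i + j)\<close>, 8 is the running
  sum, and register \<open>10 + i\<close> stores \<open>x i\<close>. Cells beyond the input still contain their initial 0.\<close>

definition ext_prog :: "instr list" where
  "ext_prog =
   [READ (Reg 1), READ (Reg 2), READ (Reg 3), LOAD (Imm 10), STORE (Reg 5),
    LOAD (Reg 2), ADD (Imm 10), SUB (Reg 5), JZERO 14,
    READ (Ind 5), LOAD (Reg 5), ADD (Imm 1), STORE (Reg 5), JUMP 5,
    LOAD (Reg 2), DIV (Imm 4), STORE (Reg 4), ADD (Imm 10), STORE (Reg 6),
    LOAD (Reg 3), JZERO 55, SUB (Imm 1), STORE (Reg 3),
    LOAD (Imm 0), STORE (Reg 8), LOAD (Imm 10), STORE (Reg 5), LOAD (Reg 6), STORE (Reg 7),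
    LOAD (Reg 4), ADD (Imm 10), SUB (Reg 5), JZERO 44,
    LOAD (Ind 5), MULT (Ind 7), ADD (Reg 8), STORE (Reg 8),
    LOAD (Reg 5), ADD (Imm 1), STORE (Reg 5), LOAD (Reg 7), ADD (Imm 1), STORE (Reg 7), JUMP 29,
    LOAD (Reg 8), DIV (Reg 1), MULT (Reg 1), STORE (Reg 7), LOAD (Reg 8), SUB (Reg 7),
    WRITE (Reg 0), LOAD (Reg 6), ADD (Imm 1), STORE (Reg 6), JUMP 19,
    HALT]"

text \<open>The default 0 mirrors registers that the input never reached; they are read when
  \<open>t\<close> is so large that \<open>k + i + j\<close> passes \<open>n\<close>.\<close>

definition pad :: "nat \<Rightarrow> (nat \<Rightarrow> int) \<Rightarrow> nat \<Rightarrow> int" where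
  "pad n x i = (if i < n then x i else 0)"

text \<open>\<open>m\<close> bounds the bit length of all values in a run: \<open>20 + n + t\<close>
  covers constants and addresses, \<open>p\<close> the coordinates, \<open>n * p^2\<close> the
  running sum.\<close>

locale ext_input =
  fixes p n t m :: nat and x :: "nat \<Rightarrow> int"
  assumes p_pos: "0 < p"
    and m_ge: "20 + int n + int t + int p + int n * (int p)\<^sup>2 < 2 ^ m"
    and x_range: "i < n \<Longrightarrow> 0 \<le> x i \<and> x i < int p"
begin

abbreviation "cell \<equiv> pad n x"

abbreviation "k \<equiv> n div 4"

text \<open>The content of register 8 after \<open>l\<close> rounds of the inner loop for output
  \<open>j\<close>.\<close>

definition conv :: "nat \<Rightarrow> nat \<Rightarrow> int" where
  "conv j l = (\<Sum>i<l. cell i * cell (k + i + j))"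

lemma cell_range: "0 \<le> cell i" "cell i < int p"
  using x_range[of i] p_pos by (auto simp: pad_def)

lemma m_pos: "0 < m"
proof (rule ccontr)
  assume "\<not> 0 < m"
  then have "(2::int) ^ m = 1" by simp
  moreover have "0 \<le> int n * (int p)\<^sup>2" by simp
  ultimately show False using m_ge by linarith
qed

lemma len_small:
  assumes "0 \<le> v" "v \<le> 20 + int n + int t + int p + int n * (int p)\<^sup>2"
  shows "len v \<le> m"
  using assms m_ge m_pos by (intro len_le) auto

lemma len_small_linear [simp]:
  assumes "0 \<le> v" "v \<le> 20 + int n + int t + int p"
  shows "len v \<le> m"
proof -
  have "0 \<le> int n * (int p)\<^sup>2" by simp
  with assms show ?thesis by (intro len_small) linarith+
qed

lemma cell_mult_range: "0 \<le> cell i * cell j" "cell i * cell j \<le> (int p)\<^sup>2"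
  using cell_range[of i] cell_range[of j] mult_mono[of "cell i" "int p" "cell j" "int p"]
  by (auto simp: power2_eq_square)

lemma conv_range:
  assumes "l \<le> n"
  shows "0 \<le> conv j l" "conv j l \<le> int n * (int p)\<^sup>2"
proof -
  show "0 \<le> conv j l" unfolding conv_def by (intro sum_nonneg cell_mult_range)
  have "conv j l \<le> (\<Sum>i<l. (int p)\<^sup>2)" unfolding conv_def by (intro sum_mono cell_mult_range)
  also have "\<dots> \<le> int n * (int p)\<^sup>2" using assms by (simp add: mult_right_mono)
  finally show "conv j l \<le> int n * (int p)\<^sup>2" .
qed

definition data :: "regs \<Rightarrow> bool" where
  "data r \<longleftrightarrow> r 1 = int p \<and> r 2 = int n \<and> r 4 = int k \<and> (\<forall>i. r (10 + i) = cell i)"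

text \<open>The loop head is address 5; a round takes 9 steps and the final test 4. Cells not yet
  written are 0, which yields the padding.\<close>

lemma read_loop:
  assumes "r 1 = int p" "r 2 = int n" "r 3 = int t" "r 5 = int (10 + i)" "i \<le> n"
    "\<And>l. r (10 + l) = (if l < i then x l else 0)"
  shows "\<exists>r'. run ext_prog m (9 * (n - i) + 4) (5, r, map x [i..<n], []) = Some (14, r', [], []) \<and>
     r' 1 = int p \<and> r' 2 = int n \<and> r' 3 = int t \<and> (\<forall>l. r' (10 + l) = cell l)"
  using assms
proof (induction "n - i" arbitrary: i r)
  case 0
  then have [simp]: "i = n" by simp
  have "run ext_prog m 4 (5, r, [], []) = Some (14, r(0 := 0), [], [])"
    using 0 by (simp add: run_numeral ext_prog_def)
  then show ?case using 0 by (auto simp: pad_def)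
next
  case (Suc d)
  then have i: "i < n" by simp
  let ?r = "r(10 + i := x i, 0 := int (11 + i), 5 := int (11 + i))"
  have xs: "map x [i..<n] = x i # map x [Suc i..<n]" using i by (simp add: upt_conv_Cons)
  have 1: "run ext_prog m 9 (5, r, map x [i..<n], []) = Some (5, ?r, map x [Suc i..<n], [])"
    using Suc.prems i x_range[OF i] unfolding xs
    by (simp add: run_numeral ext_prog_def nat_add_distrib Suc_le_eq m_pos)
  have "\<exists>r'. run ext_prog m (9 * (n - Suc i) + 4) (5, ?r, map x [Suc i..<n], []) = Some (14, r', [], []) \<and>
     r' 1 = int p \<and> r' 2 = int n \<and> r' 3 = int t \<and> (\<forall>l. r' (10 + l) = cell l)"
    using Suc.prems Suc.hyps(2) i by (intro Suc.hyps(1)) (auto simp: less_Suc_eq)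
  then obtain r' where r': "run ext_prog m (9 * (n - Suc i) + 4) (5, ?r, map x [Suc i..<n], []) = Some (14, r', [], [])"
     "r' 1 = int p" "r' 2 = int n" "r' 3 = int t" "\<forall>l. r' (10 + l) = cell l"
    by blast
  have "9 * (n - i) + 4 = 9 + (9 * (n - Suc i) + 4)" using i by simp
  with run_add[OF 1 r'(1)] r'(2-) show ?case by metis
qed

text \<open>The loop head is address 29; a round takes 15 steps and the final test 4.\<close>

lemma inner_loop:
  assumes "data r" "r 3 = int b" "b \<le> t" "r 5 = int (10 + i)" "r 6 = int (10 + k + j)" "r 7 = int (10 + k + i + j)"
    "r 8 = conv j i" "i \<le> k" "j \<le> t"
  shows "\<exists>r'. run ext_prog m (15 * (k - i) + 4) (29, r, [], ys) = Some (44, r', [], ys) \<and>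
     data r' \<and> r' 3 = int b \<and> r' 6 = int (10 + k + j) \<and> r' 8 = conv j k"
  using assms
proof (induction "k - i" arbitrary: i r)
  case 0
  then have [simp]: "i = k" by simp
  have "run ext_prog m 4 (29, r, [], ys) = Some (44, r(0 := 0), [], ys)"
    using 0 by (simp add: run_numeral ext_prog_def data_def)
  then show ?case using 0 by (auto simp: data_def)
next
  case (Suc d)
  then have i: "i < k" by simp
  have i_le: "i \<le> n" "k + i \<le> n" and k_le: "k \<le> n" using i by auto
  have conv_Suc: "conv j (Suc i) = cell i * cell (k + i + j) + conv j i"
    by (simp add: conv_def)
  \<comment> \<open>\<open>MULT\<close> leaves the bare product in the accumulator before the
    running sum is added, so it needs a length bound of its own.\<close>
  have prod_le: "cell i * cell (k + i + j) \<le> conv j (Suc i)"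
    using conv_range[of i j] i by (simp add: conv_Suc)
  have "0 \<le> conv j (Suc i)" "conv j (Suc i) \<le> int n * (int p)\<^sup>2"
    using conv_range[of "Suc i" j] i by auto
  then have len_s: "len (cell i * cell (k + i + j)) \<le> m" "len (conv j i) \<le> m"
    "len (cell i * cell (k + i + j) + conv j i) \<le> m"
    using prod_le cell_mult_range[of i "k + i + j"] conv_range(1)[OF i_le(1), of j] i
    by (auto intro!: len_small simp: conv_Suc simp del: zero_le_mult_iff)
  have cells: "r (10 + i) = cell i" "r (10 + k + i + j) = cell (k + i + j)"
    "r (Suc 0) = int p" "r 2 = int n" "r 4 = int k"
    using Suc.prems(1) by (auto simp: data_def add.assoc)
  let ?r = "r(8 := conv j (Suc i), 5 := int (11 + i), 0 := int (11 + k + i + j), 7 := int (11 + k + i + j))"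
  have 1: "run ext_prog m 15 (29, r, [], ys) = Some (29, ?r, [], ys)"
    using Suc.prems(2-) i i_le k_le cells len_s cell_range[of i] cell_range[of "k + i + j"]
    by (simp add: run_numeral ext_prog_def nat_add_distrib Suc_le_eq m_pos conv_Suc add.assoc)
  have "\<exists>r'. run ext_prog m (15 * (k - Suc i) + 4) (29, ?r, [], ys) = Some (44, r', [], ys) \<and>
     data r' \<and> r' 3 = int b \<and> r' 6 = int (10 + k + j) \<and> r' 8 = conv j k"
    using Suc.prems Suc.hyps(2) i by (intro Suc.hyps(1)) (auto simp: data_def)
  then obtain r' where r': "run ext_prog m (15 * (k - Suc i) + 4) (29, ?r, [], ys) = Some (44, r', [], ys)"
     "data r'" "r' 3 = int b" "r' 6 = int (10 + k + j)" "r' 8 = conv j k"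
    by blast
  have "15 * (k - i) + 4 = 15 + (15 * (k - Suc i) + 4)" using i by simp
  with run_add[OF 1 r'(1)] r'(2-) show ?case by metis
qed

text \<open>10 steps of set-up, \<open>15 * k + 4\<close> for the inner loop, and 11 to reduce,
  write and advance.\<close>

lemma output_step:
  assumes "data r" "r 3 = int (Suc b)" "Suc b \<le> t" "r 6 = int (10 + k + j)" "j \<le> t"
  shows "\<exists>r'. run ext_prog m (15 * k + 25) (19, r, [], ys) = Some (19, r', [], ys @ [conv j k mod int p]) \<and>
     data r' \<and> r' 3 = int b \<and> r' 6 = int (10 + k + Suc j)"
proof -
  let ?r = "r(3 := int b, 8 := 0, 5 := 10, 0 := int (10 + k + j), 7 := int (10 + k + j))"
  have 1: "run ext_prog m 10 (19, r, [], ys) = Some (29, ?r, [], ys)"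
    using assms by (simp add: run_numeral ext_prog_def fun_upd_twist)
  have "\<exists>r'. run ext_prog m (15 * (k - 0) + 4) (29, ?r, [], ys) = Some (44, r', [], ys) \<and>
     data r' \<and> r' 3 = int b \<and> r' 6 = int (10 + k + j) \<and> r' 8 = conv j k"
    using assms by (intro inner_loop) (auto simp: data_def conv_def)
  then obtain r' where r': "run ext_prog m (15 * k + 4) (29, ?r, [], ys) = Some (44, r', [], ys)"
    "data r'" "r' 3 = int b" "r' 6 = int (10 + k + j)" "r' 8 = conv j k"
    by auto
  have s: "0 \<le> conv j k" "conv j k \<le> int n * (int p)\<^sup>2"
    using conv_range[of k j] by auto
  have "0 \<le> conv j k div int p" using s p_pos by (simp add: pos_imp_zdiv_nonneg_iff)
  moreover have "conv j k div int p \<le> conv j k"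
    using zdiv_mono2[of "conv j k" 1 "int p"] s p_pos by simp
  moreover have "conv j k div int p * int p \<le> conv j k"
    using p_pos pos_mod_sign[of "int p" "conv j k"] div_mult_mod_eq[of "conv j k" "int p"] by linarith
  ultimately have len_s: "len (conv j k) \<le> m" "len (conv j k div int p) \<le> m"
    "len (conv j k div int p * int p) \<le> m"
    using s by (auto intro!: len_small)
  have len_out: "0 \<le> conv j k mod int p" "conv j k mod int p < int p" using p_pos by auto
  \<comment> \<open>The machine has no remainder instruction and subtracts \<open>p\<close> times
    the quotient instead.\<close>
  have sub: "conv j k - conv j k div int p * int p = conv j k mod int p"
    by (simp add: minus_div_mult_eq_mod)
  let ?r' = "r'(7 := conv j k div int p * int p, 0 := int (11 + k + j), 6 := int (11 + k + j))"
  have 2: "run ext_prog m 11 (44, r', [], ys) = Some (19, ?r', [], ys @ [conv j k mod int p])"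
    using r'(2-) assms(5) len_s len_out
    by (simp add: run_numeral ext_prog_def data_def Suc_le_eq m_pos sub add.assoc)
  have "10 + (15 * k + 4) + 11 = 15 * k + 25" by simp
  with run_add[OF run_add[OF 1 r'(1)] 2]
  have "run ext_prog m (15 * k + 25) (19, r, [], ys) = Some (19, ?r', [], ys @ [conv j k mod int p])"
    by metis
  then show ?thesis using r'(2-) by (intro exI[of _ ?r']) (auto simp: data_def)
qed

text \<open>Register 3 counts down while register 6 moves up: with \<open>b\<close> outputs left,
  the next index is \<open>t - b\<close>.\<close>

lemma output_loop:
  assumes "data r" "r 3 = int b" "b \<le> t" "r 6 = int (10 + k + (t - b))"
    "ys = map (\<lambda>j. conv j k mod int p) [0..<t - b]"
  shows "\<exists>r'. run ext_prog m ((15 * k + 25) * b + 2) (19, r, [], ys) =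
     Some (55, r', [], map (\<lambda>j. conv j k mod int p) [0..<t])"
  using assms
proof (induction b arbitrary: r ys)
  case 0
  have "run ext_prog m 2 (19, r, [], ys) = Some (55, r(0 := 0), [], ys)"
    using 0 by (simp add: run_numeral ext_prog_def)
  then show ?case unfolding mult_0_right add_0 using 0 by auto
next
  case (Suc b)
  have S: "Suc (t - Suc b) = t - b" using Suc.prems by simp
  from output_step[OF Suc.prems(1-4), of ys] obtain r' where
    r': "run ext_prog m (15 * k + 25) (19, r, [], ys) =
       Some (19, r', [], ys @ [conv (t - Suc b) k mod int p])"
    "data r'" "r' 3 = int b" "r' 6 = int (10 + k + Suc (t - Suc b))"
    by auto
  have "ys @ [conv (t - Suc b) k mod int p] = map (\<lambda>j. conv j k mod int p) [0..<t - b]"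
    using Suc.prems(5) unfolding S[symmetric] by simp
  then obtain r'' where r'': "run ext_prog m ((15 * k + 25) * b + 2)
      (19, r', [], ys @ [conv (t - Suc b) k mod int p]) =
     Some (55, r'', [], map (\<lambda>j. conv j k mod int p) [0..<t])"
    using Suc.IH[OF r'(2,3)] Suc.prems(3) r'(4) unfolding S by auto
  have "(15 * k + 25) * Suc b + 2 = (15 * k + 25) + ((15 * k + 25) * b + 2)" by simp
  with run_add[OF r'(1) r''] show ?case by metis
qed

text \<open>Steps: 5 for parameters and first pointer, \<open>9 * n + 4\<close> for reading, 5 to
  set \<open>k\<close> and register 6, \<open>(15 * k + 25) * t + 2\<close> for output.\<close>

lemma ext_prog_computes:
  "\<exists>T \<le> 4 * m * (9 * n + (15 * k + 25) * t + 16) + 1.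
     ram_computes ext_prog ([int p, int n, int t] @ map x [0..<n])
       (map (\<lambda>j. conv j k mod int p) [0..<t]) T"
proof -
  let ?r = "(\<lambda>_. 0)(1 := int p, 2 := int n, 3 := int t, 0 := 10, 5 := 10) :: regs"
  have 1: "run ext_prog m 5 (0, \<lambda>_. 0, [int p, int n, int t] @ map x [0..<n], []) =
      Some (5, ?r, map x [0..<n], [])"
    by (simp add: run_numeral ext_prog_def)
  obtain r where r: "run ext_prog m (9 * n + 4) (5, ?r, map x [0..<n], []) = Some (14, r, [], [])"
     "r 1 = int p" "r 2 = int n" "r 3 = int t" "\<And>l. r (10 + l) = cell l"
    using read_loop[of ?r 0] by auto
  let ?r' = "r(4 := int k, 0 := int (10 + k), 6 := int (10 + k))"
  have div4: "int n div 4 = int k" by (simp add: zdiv_int)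
  have 2: "run ext_prog m 5 (14, r, [], []) = Some (19, ?r', [], [])"
    using r(2-) div4 by (simp add: run_numeral ext_prog_def add.commute)
  obtain r'' where 3: "run ext_prog m ((15 * k + 25) * t + 2) (19, ?r', [], []) =
     Some (55, r'', [], map (\<lambda>j. conv j k mod int p) [0..<t])"
    using output_loop[of ?r' t "[]"] r(2-) by (auto simp: data_def)
  have "run ext_prog m (9 * n + (15 * k + 25) * t + 16)
      (0, \<lambda>_. 0, [int p, int n, int t] @ map x [0..<n], []) =
      Some (55, r'', [], map (\<lambda>j. conv j k mod int p) [0..<t])"
    using run_add[OF run_add[OF run_add[OF 1 r(1)] 2] 3] by (simp add: ac_simps)
  from ram_halts_if_run[OF this] show ?thesis
    unfolding ram_computes_def by (simp add: ext_prog_def)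
qed

end

section \<open>Explicitness and error bound\<close>

text \<open>Padding makes this what the program writes for every \<open>t\<close>, even beyond
  \<open>n\<close>.\<close>

definition conv_ext :: "nat \<Rightarrow> nat \<Rightarrow> nat \<Rightarrow> (nat \<Rightarrow> int) \<Rightarrow> nat \<Rightarrow> int" where
  "conv_ext p n t x =
     (\<lambda>j\<in>{..<t}. (\<Sum>i<n div 4. pad n x i * pad n x (n div 4 + i + j)) mod int p)"

text \<open>Each of \<open>n + t\<close>, \<open>p\<close> and \<open>n * p^2\<close> is at most
  \<open>A = 2^(2 * s)\<close>, and \<open>20 + 3 * A < 32 * A\<close>.\<close>

lemma register_bound:
  fixes n t p :: nat
  defines "s \<equiv> n + t + floorlog 2 p"
  shows "20 + int n + int t + int p + int n * (int p)\<^sup>2 < 2 ^ (2 * s + 5)"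
proof -
  define A :: nat where "A = 2 ^ (2 * s)"
  have "p < 2 ^ floorlog 2 p" by (rule floorlog_leD[OF order_refl]) simp
  then have p: "p \<le> 2 ^ floorlog 2 p" by simp
  have n: "n \<le> 2 ^ n" using less_exp[of n] by simp
  have "n + t < 2 ^ (n + t)" by (rule less_exp)
  also have "\<dots> \<le> A" unfolding A_def by (rule power_increasing) (auto simp: s_def)
  finally have nt: "n + t \<le> A" by simp
  have "(2::nat) ^ floorlog 2 p \<le> A" unfolding A_def by (rule power_increasing) (auto simp: s_def)
  with p have pA: "p \<le> A" by simp
  have "n * p\<^sup>2 \<le> 2 ^ n * (2 ^ floorlog 2 p)\<^sup>2" by (intro mult_mono power_mono p n) auto
  also have "\<dots> = 2 ^ (n + 2 * floorlog 2 p)" by (simp add: power_add power_even_eq)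
  also have "\<dots> \<le> A" unfolding A_def by (rule power_increasing) (auto simp: s_def)
  finally have np: "n * p\<^sup>2 \<le> A" .
  have "1 \<le> A" by (simp add: A_def)
  with nt pA np have "20 + n + t + p + n * p\<^sup>2 < 32 * A" by linarith
  also have "32 * A = 2 ^ (2 * s + 5)" by (simp add: A_def power_add)
  finally have "int (20 + n + t + p + n * p\<^sup>2) < int (2 ^ (2 * s + 5))" by (rule less_imp_of_nat_less)
  then show ?thesis by simp
qed

text \<open>With \<open>m = 2 * s + 5\<close>, the factor \<open>[:20, 8:]\<close> is
  \<open>4 * m\<close>, \<open>[:16, 34, 15:]\<close> bounds the number of steps, and
  \<open>HALT\<close> adds 1.\<close>

lemma conv_ext_explicit:
  assumes "0 < p"
  shows "explicit_by ext_prog ([:20, 8:] * [:16, 34, 15:] + 1) p n t (conv_ext p n t)"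
  unfolding explicit_by_def
proof
  fix x assume x: "x \<in> carrier (Fp_vec p n)"
  define s where "s = n + t + floorlog 2 p"
  interpret ext_input p n t "2 * s + 5" x
    using assms register_bound[of n t p] vecs_range[of x p n] x
    by unfold_locales (auto simp: s_def carrier_Fp_vec)
  have "(15 * (n div 4) + 25) * t \<le> (15 * s + 25) * s" by (intro mult_mono) (auto simp: s_def)
  then have steps: "9 * n + (15 * (n div 4) + 25) * t + 16 \<le> 9 * s + (15 * s + 25) * s + 16"
    by (intro add_mono) (auto simp: s_def)
  have "4 * (2 * s + 5) * (9 * n + (15 * (n div 4) + 25) * t + 16) + 1
      \<le> 4 * (2 * s + 5) * (9 * s + (15 * s + 25) * s + 16) + 1"
    by (rule add_right_mono[OF mult_left_mono[OF steps]]) simp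
  also have "\<dots> = poly ([:20, 8:] * [:16, 34, 15:] + 1) s"
    by (simp add: algebra_simps)
  finally have "4 * (2 * s + 5) * (9 * n + (15 * (n div 4) + 25) * t + 16) + 1
      \<le> poly ([:20, 8:] * [:16, 34, 15:] + 1) s" .
  moreover have "map (\<lambda>j. conv j (n div 4) mod int p) [0..<t] = map (conv_ext p n t x) [0..<t]"
    by (simp add: conv_ext_def conv_def)
  moreover obtain T where "T \<le> 4 * (2 * s + 5) * (9 * n + (15 * (n div 4) + 25) * t + 16) + 1"
    "ram_computes ext_prog ([int p, int n, int t] @ map x [0..<n])
       (map (\<lambda>j. conv j (n div 4) mod int p) [0..<t]) T"
    using ext_prog_computes by blast
  ultimately show "\<exists>T\<le>poly ([:20, 8:] * [:16, 34, 15:] + 1) (n + t + floorlog 2 p).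
      ram_computes ext_prog ([int p, int n, int t] @ map x [0..<n]) (map (conv_ext p n t x) [0..<t]) T"
    unfolding s_def[symmetric] by (intro exI[of _ T] conjI) (erule (1) order_trans, simp only:)
qed

lemma conv_ext_in_vecs: "0 < p \<Longrightarrow> conv_ext p n t x \<in> vecs p t"
  by (auto simp: vecs_def conv_ext_def)

section \<open>Error of the extractor\<close>

lemma stat_dist_conv_ext_le:
  assumes "prime p" "2 * (n div 4) + t \<le> n"
    and D: "D \<in> biased_sources (Fp_vec p n) \<epsilon> e" and \<epsilon>: "0 \<le> \<epsilon>"
  shows "stat_dist (map_pmf (conv_ext p n t) D) (pmf_of_set (vecs p t))
    \<le> sqrt (real p ^ t) * (real e / real p ^ (n div 4) + real p ^ (n div 4) * \<epsilon>)"
proof (rule stat_dist_le_characters)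
  show p: "0 < p" using assms(1) prime_gt_0_nat by blast
  show "set_pmf (map_pmf (conv_ext p n t) D) \<subseteq> vecs p t" using conv_ext_in_vecs[OF p] by auto
  show "0 \<le> real e / real p ^ (n div 4) + real p ^ (n div 4) * \<epsilon>" using \<epsilon> by simp
  fix a j assume j: "j < t" "\<not> int p dvd a j"
  let ?k = "n div 4"
  \<comment> \<open>Modulo \<open>p\<close>, the form \<open>a\<close> of the output is the bilinear
    phase; all indices stay below \<open>n\<close>, so the padding disappears.\<close>
  have "unit_exp p (\<Sum>j<t. a j * conv_ext p n t x j) = unit_exp p (\<Sum>i<?k. \<Sum>j<t. x i * a j * x (?k + i + j))" for x
  proof (rule unit_exp_cong[OF p])
    have "[(\<Sum>j<t. a j * conv_ext p n t x j) =
        (\<Sum>j<t. a j * (\<Sum>i<?k. pad n x i * pad n x (?k + i + j)))] (mod int p)"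
      by (intro cong_sum cong_mult) (auto simp: conv_ext_def cong_def)
    also have "(\<Sum>j<t. a j * (\<Sum>i<?k. pad n x i * pad n x (?k + i + j))) =
        (\<Sum>j<t. \<Sum>i<?k. x i * a j * x (?k + i + j))"
      unfolding sum_distrib_left using assms(2) by (intro sum.cong refl) (auto simp: pad_def)
    also have "\<dots> = (\<Sum>i<?k. \<Sum>j<t. x i * a j * x (?k + i + j))" by (rule sum.swap)
    finally show "[(\<Sum>j<t. a j * conv_ext p n t x j) =
        (\<Sum>i<?k. \<Sum>j<t. x i * a j * x (?k + i + j))] (mod int p)" .
  qed
  then show "cmod (measure_pmf.expectation (map_pmf (conv_ext p n t) D) (\<lambda>y. unit_exp p (\<Sum>i<t. a i * y i)))
      \<le> real e / real p ^ ?k + real p ^ ?k * \<epsilon>"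
    using expectation_conv_le[OF assms(1,2) j(1), of a, OF j(2) D \<epsilon>] by simp
qed

text \<open>The second summand is at most \<open>d * p^(-k)\<close> since
  \<open>k \<le> n / 4\<close>. The hypothesis on \<open>t\<close> bounds \<open>d * e\<close> by
  \<open>\<epsilon>' * p^((n/16 - t)/2)\<close>, whose \<open>-t/2\<close> cancels
  \<open>sqrt (p^t)\<close>.\<close>

lemma conv_ext_error_le:
  fixes d \<epsilon>' :: real
  assumes p: "2 \<le> p" and n: "16 \<le> n" and e: "0 < e" and d: "1 \<le> d" and \<epsilon>': "0 < \<epsilon>'"
    and t: "real t * log 2 p \<le> real n / 16 * log 2 p - 2 * log 2 (d * e / \<epsilon>')"
  shows "sqrt (real p ^ t) * (real e / real p ^ (n div 4) +
    real p ^ (n div 4) * (d * real p powr (- (real n / 2)))) \<le> \<epsilon>'"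
proof -
  define k where "k = n div 4"
  have k: "real k \<le> real n / 4" "real n / 4 - 3 / 4 \<le> real k" unfolding k_def by linarith+
  have pos: "0 < real p" "1 \<le> real p" using p by auto
  have e1: "1 \<le> real e" using e by simp
  have quot: "0 < d * e / \<epsilon>'" using d e \<epsilon>' by simp
  have "log 2 (d * e / \<epsilon>') \<le> log 2 (real p powr ((real n / 16 - real t) / 2))"
    using t pos by (simp add: log_powr field_simps)
  then have "d * e / \<epsilon>' \<le> real p powr ((real n / 16 - real t) / 2)"
    using quot pos by simp
  then have de: "d * e \<le> \<epsilon>' * real p powr ((real n / 16 - real t) / 2)"
    using \<epsilon>' by (simp add: field_simps)
  have "real p ^ k * (d * real p powr (- (real n / 2))) = d * real p powr (real k + - (real n / 2))"
    using pos unfolding powr_add by (simp add: powr_realpow)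
  also have "\<dots> \<le> d * real p powr (- real k)"
    using pos d k by (intro mult_left_mono powr_mono) auto
  finally have "real p ^ k * (d * real p powr (- (real n / 2))) \<le> d * real p powr (- real k)" .
  moreover have "real e / real p ^ k = real e * real p powr (- real k)"
    using pos by (simp add: powr_minus_divide powr_realpow)
  ultimately have "real e / real p ^ k + real p ^ k * (d * real p powr (- (real n / 2)))
      \<le> real e * real p powr (- real k) + d * real p powr (- real k)"
    by linarith
  also have "\<dots> = (real e + d) * real p powr (- real k)" by (simp add: ring_distribs)
  \<comment> \<open>Since \<open>d\<close> and \<open>e\<close> are at least 1,
    \<open>e + d \<le> 2 * d * e\<close>; the 2 is absorbed into one factor
    \<open>p\<close>.\<close>
  also have "\<dots> \<le> (real p * (d * e)) * real p powr (- real k)"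
  proof (rule mult_right_mono)
    have "0 \<le> (real e - 1) * (d - 1)" using e1 d by simp
    then have "real e + d \<le> 1 + d * e" by (simp add: algebra_simps)
    also have "\<dots> \<le> 2 * (d * e)" using mult_mono[of 1 d 1 "real e"] e1 d by simp
    also have "\<dots> \<le> real p * (d * e)" using p e d by (intro mult_right_mono) auto
    finally show "real e + d \<le> real p * (d * e)" .
  qed simp
  also have "\<dots> = d * e * real p powr (1 + - real k)" using pos unfolding powr_add by simp
  also have "\<dots> \<le> \<epsilon>' * real p powr ((real n / 16 - real t) / 2) * real p powr (1 + - real k)"
    by (intro mult_right_mono de) auto
  finally have bound: "real e / real p ^ k + real p ^ k * (d * real p powr (- (real n / 2)))
      \<le> \<epsilon>' * real p powr ((real n / 16 - real t) / 2) * real p powr (1 + - real k)" .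
  have "16 \<le> real n" using n by simp
  \<comment> \<open>After \<open>t\<close> cancels, \<open>k \<ge> n/4 - 3/4\<close> bounds the
    exponent by \<open>7/4 - 7 * n / 32\<close>, which is negative here.\<close>
  then have expo: "real t / 2 + (real n / 16 - real t) / 2 + (1 + - real k) \<le> 0"
    using k by (simp add: field_simps)
  have "sqrt (real p ^ t) = real p powr (real t / 2)"
    using pos by (simp add: powr_half_sqrt[symmetric] powr_realpow[symmetric] powr_powr)
  then have "sqrt (real p ^ t) * (real e / real p ^ k + real p ^ k * (d * real p powr (- (real n / 2))))
      \<le> real p powr (real t / 2) *
         (\<epsilon>' * real p powr ((real n / 16 - real t) / 2) * real p powr (1 + - real k))"
    using mult_left_mono[OF bound, of "real p powr (real t / 2)"] by simp
  also have "\<dots> = \<epsilon>' * real p powr (real t / 2 + (real n / 16 - real t) / 2 + (1 + - real k))"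
    unfolding powr_add[of _ _ "1 + - real k"] powr_add[of _ "real t / 2"] by simp
  also have "\<dots> \<le> \<epsilon>' * real p powr 0"
    using expo pos \<epsilon>' by (intro mult_left_mono powr_mono) auto
  finally show ?thesis using pos by (simp add: k_def)
qed

theorem theorem3p18:
  shows "\<exists>c > (0::real). \<exists>(M :: instr list) (q :: nat poly).
    \<forall>(p::nat) (n::nat) (t::nat) (e::nat) (d::real) (\<epsilon>'::real) (\<epsilon>::real).
      prime p \<longrightarrow> 0 < n \<longrightarrow> 0 < t \<longrightarrow> 0 < e \<longrightarrow> 1 \<le> d \<longrightarrow> 0 < \<epsilon>' \<longrightarrow>
      c \<le> real n \<longrightarrow>
      real t * log 2 (real p) \<le> inverse c * real n * log 2 (real p) - 2 * log 2 (d * real e / \<epsilon>') \<longrightarrow>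
      \<epsilon> = d * real p powr (- (real n / 2)) \<longrightarrow>
      (\<exists>f. explicit_by M q p n t f \<and>
           extractor \<epsilon>' (carrier (Fp_vec p n)) (carrier (Fp_vec p t))
             (biased_sources (Fp_vec p n) \<epsilon> e) f)"
proof (intro exI conjI allI impI)
  \<comment> \<open>16 is both the threshold for \<open>n\<close> and the inverse rate in the error
    bound.\<close>
  show "(0::real) < 16" by simp
  fix p n t e :: nat and d \<epsilon>' \<epsilon> :: real
  assume p: "prime p" and "0 < n" "0 < t" and e: "0 < e" and d: "1 \<le> d" and \<epsilon>': "0 < \<epsilon>'"
    and n: "16 \<le> real n"
    and t: "real t * log 2 (real p) \<le> inverse 16 * real n * log 2 (real p) - 2 * log 2 (d * real e / \<epsilon>')"
    and \<epsilon>: "\<epsilon> = d * real p powr (- (real n / 2))"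
  have p0: "0 < p" and p2: "2 \<le> p" using p prime_gt_0_nat prime_ge_2_nat by auto
  \<comment> \<open>Program and polynomial do not mention the parameters, as witnesses chosen before
    them must not.\<close>
  show "explicit_by ext_prog ([:20, 8:] * [:16, 34, 15:] + 1) p n t (conv_ext p n t)"
    by (rule conv_ext_explicit[OF p0])
  have "stat_dist (map_pmf (conv_ext p n t) D) (pmf_of_set (vecs p t)) \<le> \<epsilon>'"
    if D: "D \<in> biased_sources (Fp_vec p n) \<epsilon> e" for D
  proof (cases "\<epsilon>' < 1")
    case True
    \<comment> \<open>For \<open>\<epsilon>' < 1\<close> the logarithm is nonnegative, so
      \<open>t \<le> n / 16\<close> and the correlations fit into \<open>n\<close>
      coordinates.\<close>
    have "1 * 1 \<le> d * real e" using d e by (intro mult_mono) auto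
    then have "1 \<le> d * real e / \<epsilon>'" using True \<epsilon>' by (simp add: field_simps)
    then have "0 \<le> log 2 (d * real e / \<epsilon>')" by simp
    with t have "real t * log 2 (real p) \<le> real n / 16 * log 2 (real p)" by simp
    moreover have "0 < log 2 (real p)" using p2 by simp
    ultimately have "real t \<le> real n / 16" by (simp only: mult_le_cancel_right_pos)
    then have "2 * (n div 4) + t \<le> n" by linarith
    from stat_dist_conv_ext_le[OF p this D] have
      "stat_dist (map_pmf (conv_ext p n t) D) (pmf_of_set (vecs p t))
        \<le> sqrt (real p ^ t) * (real e / real p ^ (n div 4) + real p ^ (n div 4) * \<epsilon>)"
      using d \<epsilon> by simp
    also have "\<dots> \<le> \<epsilon>'"
      unfolding \<epsilon> using n t by (intro conv_ext_error_le p2 e d \<epsilon>') auto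
    finally show ?thesis .
  next
    case False
    then show ?thesis using stat_dist_le_1[of "map_pmf (conv_ext p n t) D" "pmf_of_set (vecs p t)"]
      by linarith
  qed
  then show "extractor \<epsilon>' (carrier (Fp_vec p n)) (carrier (Fp_vec p t))
      (biased_sources (Fp_vec p n) \<epsilon> e) (conv_ext p n t)"
    using conv_ext_in_vecs[OF p0] by (auto simp: extractor_def carrier_Fp_vec)
qed

end
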